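(* Let $f,g,h,p$ satisfy the standing assumption (a)--(d) and suppose $L_f+L_h>0$. Let $\rho_f\in[0,L_f]$ be such that $f$ is $\rho_f$-weakly convex, and let $\sigma_h\in\mathbb R$ be such that $h-\frac{\sigma_h}{2}\|\cdot\|^2$ is convex. Let $\tau\in(1,2)$ and define $$\bar\alpha:=\begin{cases}\bar\alpha_1 & \text{if } \tau\le 2\bar\alpha_1(L_f-\rho_f),\\ \dfrac{\tau}{2\eta^*} & \text{otherwise,}\end{cases}$$ where $\bar\alpha_1$ is the positive root of $$c_1(\alpha):=2L_f(L_f+L_h)\alpha^2+\big(\tau L_h-2(\tau-1)\sigma_h-\tau L_f\big)\alpha-(2-\tau)$$ and $\eta^*$ is the positive root of $$q(\eta):=2(2-\tau)\eta^2-\tau\big(\tau L_h-2(\tau-1)\sigma_h+\rho_f\tau\big)\eta-\tau^2(\rho_f^2+L_fL_h).$$ If $\{(x^k,y^k,z^k)\}$ is generated by the algorithm with this $\tau$ and with $\alpha\in(0,\bar\alpha]$, then for all $k\ge1$ $$V_{k-1}-V_k\ \ge\ -\frac{c(\alpha)}{2\tau\alpha}\|x^k-x^{k-1}\|^2+\frac{1-\beta\rho_p}{2\beta}\|y^k-y^{k-1}\|^2,$$ where $c(\alpha)=c_1(\alpha)$ if $\tau\le2\bar\alpha_1(L_f-\rho_f)$, and $$c(\alpha)=2L_fL_h\alpha^2+\Big(\tau L_h-2(\tau-1)\sigma_h+\frac{\rho_f\tau(\eta^*+\rho_f)}{\eta^*}\Big)\alpha-(2-\tau)$$ otherwise. In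 particular, $\{V_k\}$ is nonincreasing if $\alpha\le\bar\alpha$ and $\beta\le\rho_p^{-1}$, and strictly decreasing if at least one of these holds with strict inequality.
   Context: Notation. $\mathbb R^n$ carries the Euclidean inner product and norm. A function is $L$-smooth if it is continuously differentiable with $L$-Lipschitz gradient; $\phi$ is $\rho$-weakly convex ($\rho\ge0$) if $\phi+\frac{\rho}{2}\|\cdot\|^2$ is convex. $\partial\phi$ denotes the limiting (Mordukhovich) subdifferential: $\xi\in\partial\phi(x)$ iff there are $x^k\to x$ with $\phi(x^k)\to\phi(x)$ and $\xi^k\to\xi$ with $\liminf_{\bar x\to x^k,\bar x\ne x^k}\frac{\phi(\bar x)-\phi(x^k)-\langle\xi^k,\bar x-x^k\rangle}{\|\bar x-x^k\|}\ge0$ for each $k$. The proximal mapping is $\mathrm{prox}_{\gamma\phi}(x)=\arg\min_w\{\phi(w)+\frac1{2\gamma}\|w-x\|^2\}$ (set-valued). Standing assumption. (a) $f:\mathbb R^n\to\mathbb R$ is $L_f$-smooth and proximable; (b) $g:\mathbb R^n\to(-\infty,\infty]$ is proper, closed (lower semicontinuous) and proximable; (c) $h:\mathbb R^n\to\mathbb R$ is $L_h$-smooth; (d) $p:\mathbb R^n\to\mathbb R$ is continuous on an open set containing $\mathrm{dom}(g)$ and $-p$ is $\rho_p$-weakly convex, $\rho_p\ge0$. ("Proximable" informally means that the proximal mapping is easily computable.) Conventions: $a/\infty=0$, $a/0=\infty$ for $a\ne0$, $\infty/\infty=1$; so $\rho_p^{-1}=\infty$ if $\rho_p=0$, and $\frac{1-\beta\rho_p}{2\beta}$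 means $\frac1{2\beta}-\frac{\rho_p}2$ when $\beta=\infty$. Algorithm. Parameters: $\tau>0$, $\alpha\in(0,\infty)$, $\beta\in(0,\infty]$, $\gamma\in(0,\infty)$ with $\frac1\gamma=\frac1\alpha+\frac1\beta$. Starting from $(y^0,z^0)\in\mathbb R^n\times\mathbb R^n$, for all $k\ge0$: $x^k\in\mathrm{prox}_{\alpha f}(z^k)$; $y^{k+1}\in\mathrm{prox}_{\gamma g}\big(\frac\gamma\alpha(2x^k-z^k-\alpha\nabla h(x^k))+\frac\gamma\beta y^k-\gamma\xi^k\big)$ for some $\xi^k\in\partial p(y^k)$; $z^{k+1}=z^k+\tau(y^{k+1}-x^k)$. Merit function. For $\xi\in\partial p(y)$ put $$\Phi_{\Lambda,\xi}(w;y,z,x)=(f+h)(x)+\langle\nabla f(x)+\nabla h(x),w-x\rangle+\tfrac1{2\alpha}\|w-x\|^2+p(y)+\langle\xi,w-y\rangle+\tfrac1{2\beta}\|w-y\|^2+g(w),$$ with $\Lambda=(\alpha,\beta,\gamma)$, and $V_{\Lambda,\xi}(y,z,x)=\min_{w\in\mathbb R^n}\Phi_{\Lambda,\xi}(w;y,z,x)$. For the generated sequence, $V_k:=V_{\Lambda,\xi^k}(y^k,z^k,x^k)=\Phi_{\Lambda,\xi^k}(y^{k+1};y^k,z^k,x^k)$.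
   Formalization: In the first case, for α<τ/(2(L_f−ρ_f)), where the bound with c_1 fails, c is the second-case formula with η*=L_f−ρ_f. Strict decrease, false at fixed points, is stated as V_k<V_{k−1} if x^k≠x^{k−1} (when α<ᾱ) or if y^k≠y^{k−1} (when β<1/ρ_p). *)

theory Defs
  imports "HOL-Analysis.Analysis"
begin

definition gradient :: "('a::real_inner \<Rightarrow> real) \<Rightarrow> 'a \<Rightarrow> 'a" where
  "gradient f x = (THE D. GDERIV f x :> D)"

definition L_smooth :: "real \<Rightarrow> ('a::real_inner \<Rightarrow> real) \<Rightarrow> bool" where
  "L_smooth L f \<longleftrightarrow>
     (\<forall>x. f differentiable (at x)) \<and> continuous_on UNIV (gradient f) \<and>
     L-lipschitz_on UNIV (gradient f)"

definition weakly_convex :: "real \<Rightarrow> ('a::real_inner \<Rightarrow> real) \<Rightarrow> bool" where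
  "weakly_convex \<rho> \<phi> \<longleftrightarrow> 0 \<le> \<rho> \<and> convex_on UNIV (\<lambda>x. \<phi> x + \<rho> / 2 * (norm x)\<^sup>2)"

definition proper_fun :: "('a \<Rightarrow> ereal) \<Rightarrow> bool" where
  "proper_fun g \<longleftrightarrow> (\<forall>x. g x \<noteq> -\<infinity>) \<and> (\<exists>x. g x \<noteq> \<infinity>)"

definition lsc_fun :: "('a::topological_space \<Rightarrow> ereal) \<Rightarrow> bool" where
  "lsc_fun g \<longleftrightarrow> (\<forall>x. g x \<le> Liminf (at x) g)"

definition eff_domain :: "('a \<Rightarrow> ereal) \<Rightarrow> 'a set" where
  "eff_domain g = {x. g x < \<infinity>}"

definition regular_subdiff :: "('a::real_inner \<Rightarrow> real) \<Rightarrow> 'a \<Rightarrow> 'a set" where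
  "regular_subdiff \<phi> x =
     {\<xi>. 0 \<le> Liminf (at x) (\<lambda>u. ereal ((\<phi> u - \<phi> x - inner \<xi> (u - x)) / norm (u - x)))}"

definition limiting_subdiff :: "('a::real_inner \<Rightarrow> real) \<Rightarrow> 'a \<Rightarrow> 'a set" where
  "limiting_subdiff \<phi> x =
     {\<xi>. \<exists>X \<Xi>. X \<longlonglongrightarrow> x \<and> (\<lambda>k. \<phi> (X k)) \<longlonglongrightarrow> \<phi> x \<and> \<Xi> \<longlonglongrightarrow> \<xi> \<and>
          (\<forall>k. \<Xi> k \<in> regular_subdiff \<phi> (X k))}"

definition prox :: "real \<Rightarrow> ('a::real_normed_vector \<Rightarrow> ereal) \<Rightarrow> 'a \<Rightarrow> 'a set" where
  "prox \<gamma> \<phi> x =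
     {w. is_arg_min (\<lambda>w. \<phi> w + ereal (1 / (2 * \<gamma>) * (norm (w - x))\<^sup>2)) (\<lambda>_. True) w}"

(* The parameter beta ranges over (0, \<infinity>] and is an ereal; it enters real-valued formulas
   only through 1 / beta, which is 0 for beta = \<infinity>. *)
definition rec :: "ereal \<Rightarrow> real" where
  "rec \<beta> = real_of_ereal (inverse \<beta>)"

(* The sequence xi records the subgradients of p selected by the algorithm. *)
definition generated_by_algorithm ::
  "('a::real_inner \<Rightarrow> real) \<Rightarrow> ('a \<Rightarrow> ereal) \<Rightarrow> ('a \<Rightarrow> real) \<Rightarrow> ('a \<Rightarrow> real) \<Rightarrow>
   real \<Rightarrow> real \<Rightarrow> ereal \<Rightarrow> real \<Rightarrow>
   (nat \<Rightarrow> 'a) \<Rightarrow> (nat \<Rightarrow> 'a) \<Rightarrow> (nat \<Rightarrow> 'a) \<Rightarrow> (nat \<Rightarrow> 'a) \<Rightarrow> bool" where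
  "generated_by_algorithm f g h p \<tau> \<alpha> \<beta> \<gamma> x y z \<xi> \<longleftrightarrow>
     (\<forall>k. x k \<in> prox \<alpha> (\<lambda>u. ereal (f u)) (z k) \<and>
          \<xi> k \<in> limiting_subdiff p (y k) \<and>
          y (Suc k) \<in> prox \<gamma> g
            ((\<gamma> / \<alpha>) *\<^sub>R (2 *\<^sub>R x k - z k - \<alpha> *\<^sub>R gradient h (x k))
              + (\<gamma> * rec \<beta>) *\<^sub>R y k - \<gamma> *\<^sub>R \<xi> k) \<and>
          z (Suc k) = z k + \<tau> *\<^sub>R (y (Suc k) - x k))"

(* The argument z does not occur in the defining formula (z = x + alpha * gradient f x along
   the algorithm), nor does the parameter gamma; the latter is omitted. *)
definition Phi ::
  "('a::real_inner \<Rightarrow> real) \<Rightarrow> ('a \<Rightarrow> ereal) \<Rightarrow> ('a \<Rightarrow> real) \<Rightarrow> ('a \<Rightarrow> real) \<Rightarrow>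
   real \<Rightarrow> ereal \<Rightarrow> 'a \<Rightarrow> 'a \<Rightarrow> 'a \<Rightarrow> 'a \<Rightarrow> 'a \<Rightarrow> ereal" where
  "Phi f g h p \<alpha> \<beta> \<xi> w y z x =
     ereal ((f x + h x) + inner (gradient f x + gradient h x) (w - x)
            + 1 / (2 * \<alpha>) * (norm (w - x))\<^sup>2
            + p y + inner \<xi> (w - y) + rec \<beta> / 2 * (norm (w - y))\<^sup>2)
     + g w"

(* Infimum over w; along the algorithm it is a minimum, attained at w = y (k+1). *)
definition merit ::
  "('a::real_inner \<Rightarrow> real) \<Rightarrow> ('a \<Rightarrow> ereal) \<Rightarrow> ('a \<Rightarrow> real) \<Rightarrow> ('a \<Rightarrow> real) \<Rightarrow>
   real \<Rightarrow> ereal \<Rightarrow> 'a \<Rightarrow> 'a \<Rightarrow> 'a \<Rightarrow> 'a \<Rightarrow> ereal" where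
  "merit f g h p \<alpha> \<beta> \<xi> y z x = (INF w. Phi f g h p \<alpha> \<beta> \<xi> w y z x)"

definition positive_root :: "(real \<Rightarrow> real) \<Rightarrow> real" where
  "positive_root q = (THE r. 0 < r \<and> q r = 0)"

definition poly_c1 :: "real \<Rightarrow> real \<Rightarrow> real \<Rightarrow> real \<Rightarrow> real \<Rightarrow> real" where
  "poly_c1 \<tau> L_f L_h \<sigma>_h a =
     2 * L_f * (L_f + L_h) * a\<^sup>2 + (\<tau> * L_h - 2 * (\<tau> - 1) * \<sigma>_h - \<tau> * L_f) * a - (2 - \<tau>)"

definition poly_q :: "real \<Rightarrow> real \<Rightarrow> real \<Rightarrow> real \<Rightarrow> real \<Rightarrow> real \<Rightarrow> real" where
  "poly_q \<tau> L_f L_h \<rho>_f \<sigma>_h \<eta> =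
     2 * (2 - \<tau>) * \<eta>\<^sup>2 - \<tau> * (\<tau> * L_h - 2 * (\<tau> - 1) * \<sigma>_h + \<rho>_f * \<tau>) * \<eta>
       - \<tau>\<^sup>2 * (\<rho>_f\<^sup>2 + L_f * L_h)"

definition poly_c2 :: "real \<Rightarrow> real \<Rightarrow> real \<Rightarrow> real \<Rightarrow> real \<Rightarrow> real \<Rightarrow> real \<Rightarrow> real" where
  "poly_c2 \<tau> L_f L_h \<rho>_f \<sigma>_h \<eta> a =
     2 * L_f * L_h * a\<^sup>2
       + (\<tau> * L_h - 2 * (\<tau> - 1) * \<sigma>_h + \<rho>_f * \<tau> * (\<eta> + \<rho>_f) / \<eta>) * a - (2 - \<tau>)"

definition alpha_bar :: "real \<Rightarrow> real \<Rightarrow> real \<Rightarrow> real \<Rightarrow> real \<Rightarrow> real" where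
  "alpha_bar \<tau> L_f L_h \<rho>_f \<sigma>_h =
     (let \<alpha>\<^sub>1 = positive_root (poly_c1 \<tau> L_f L_h \<sigma>_h);
          \<eta> = positive_root (poly_q \<tau> L_f L_h \<rho>_f \<sigma>_h)
      in if \<tau> \<le> 2 * \<alpha>\<^sub>1 * (L_f - \<rho>_f) then \<alpha>\<^sub>1 else \<tau> / (2 * \<eta>))"

(* Deviation from the source. The source uses poly_c1 throughout the first case. The descent
   estimate with that coefficient is false for a < tau / (2 (L_f - rho_f)):
   on R take f = h = p = 0, g the indicator of {0}, L_f = 1, L_h = rho_f = sigma_h = rho_p = 0,
   tau = 3/2, alpha = 1/2, beta = \<infinity>. Then alpha_bar = 1, the first case applies, and
   z 0 = 1, y 0 = 0 gives x 0 = 1, x 1 = -1/2, V 0 = 1, V 1 = 1/4, whereas the claimed lower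
   bound on V 0 - V 1 is -poly_c1(1/2) / (2 tau alpha) * (9/4) = 9/8.
   For these small step sizes the proof gives poly_c2 with L_f - rho_f in place of eta-star,
   which agrees with poly_c1 at a = tau / (2 (L_f - rho_f)). Everything else is as in the
   source; monotonicity of V is unaffected. *)
definition coeff_c :: "real \<Rightarrow> real \<Rightarrow> real \<Rightarrow> real \<Rightarrow> real \<Rightarrow> real \<Rightarrow> real" where
  "coeff_c \<tau> L_f L_h \<rho>_f \<sigma>_h a =
     (let \<alpha>\<^sub>1 = positive_root (poly_c1 \<tau> L_f L_h \<sigma>_h);
          \<eta> = positive_root (poly_q \<tau> L_f L_h \<rho>_f \<sigma>_h)
      in if \<tau> \<le> 2 * \<alpha>\<^sub>1 * (L_f - \<rho>_f)
         then (if \<tau> \<le> 2 * a * (L_f - \<rho>_f) then poly_c1 \<tau> L_f L_h \<sigma>_h a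
               else poly_c2 \<tau> L_f L_h \<rho>_f \<sigma>_h (L_f - \<rho>_f) a)
         else poly_c2 \<tau> L_f L_h \<rho>_f \<sigma>_h \<eta> a)"

end

theory Submission
  imports Defs
begin

text \<open>
  Optimality of \<open>x k\<close> in the first proximal step gives \<open>z k = x k + \<alpha> \<nabla>f (x k)\<close>, and completing the
  square shows that \<open>y (k + 1)\<close> minimizes the model \<open>Phi\<close> at stage \<open>k\<close>. Hence \<open>V (k - 1) - V k\<close> is at
  least the difference of the two consecutive models at the single point \<open>y k\<close>, in which \<open>g\<close> cancels.
  The part involving \<open>p\<close> is controlled by weak convexity of \<open>- p\<close>. In the remaining part
  \<open>y k - x (k - 1) = (d + \<alpha> e) / \<tau>\<close>, where \<open>d\<close> and \<open>e\<close> are the increments of \<open>x\<close> and of \<open>\<nabla>f (x)\<close>,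
  and everything except \<open>T - \<alpha> |e|\<^sup>2 / \<tau>\<close>, with \<open>T\<close> the linearization gap of \<open>f\<close>, is bounded by a
  multiple of \<open>|d|\<^sup>2\<close>. Cocoercivity of the gradient of \<open>f + \<rho>\<^sub>f / 2 |\<cdot>|\<^sup>2\<close> bounds \<open>T\<close> from below by
  \<open>|e|\<^sup>2 / (2 \<eta>) - \<rho>\<^sub>f (\<eta> + \<rho>\<^sub>f) / (2 \<eta>) |d|\<^sup>2\<close> for every \<open>\<eta> \<ge> L\<^sub>f - \<rho>\<^sub>f\<close>, \<open>\<eta> > 0\<close>. If \<open>2 \<alpha> \<eta> \<le> \<tau>\<close>, the terms
  in \<open>|e|\<^sup>2\<close> can be dropped; otherwise one uses \<open>|e| \<le> L\<^sub>f |d|\<close>. The polynomial \<open>q\<close> is, up to the factor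
  \<open>- 2 \<eta>\<^sup>2\<close>, the resulting coefficient at the largest admissible step size \<open>\<alpha> = \<tau> / (2 \<eta>)\<close>.
\<close>

section \<open>Smooth and weakly convex functions\<close>

lemma GDERIV_unique:
  assumes "GDERIV f x :> D" and "GDERIV f x :> E"
  shows "D = E"
proof -
  have "(\<lambda>h. inner h D) = (\<lambda>h. inner h E)"
    using assms has_derivative_unique unfolding gderiv_def by blast
  then have "inner (D - E) D = inner (D - E) E" by metis
  then have "inner (D - E) (D - E) = 0" by (simp add: inner_diff_right)
  then show ?thesis by simp
qed

text \<open>In finite dimension the derivative is the inner product with a vector, so the
  description in \<open>gradient\<close> denotes that vector.\<close>

lemma L_smooth_has_derivative:
  fixes f :: "'a::euclidean_space \<Rightarrow> real"
  assumes "L_smooth L f"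
  shows "(f has_derivative (\<lambda>h. inner h (gradient f x))) (at x)"
proof -
  obtain f' where f': "(f has_derivative f') (at x)"
    using assms unfolding L_smooth_def differentiable_def by blast
  interpret linear f' using f' by (rule has_derivative_linear)
  define D where "D = (\<Sum>b\<in>Basis. f' b *\<^sub>R b)"
  have "f' h = inner h D" for h
  proof -
    have "f' h = f' (\<Sum>b\<in>Basis. inner h b *\<^sub>R b)" by (simp add: euclidean_representation)
    also have "\<dots> = inner h D" unfolding D_def
      by (simp add: sum scaleR inner_sum_right mult.commute)
    finally show ?thesis .
  qed
  then have "f' = (\<lambda>h. inner h D)" by blast
  with f' have D: "GDERIV f x :> D" unfolding gderiv_def by simp
  then have "gradient f x = D" unfolding gradient_def
    by (rule the_equality) (rule GDERIV_unique[OF _ D])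
  with D show ?thesis unfolding gderiv_def by simp
qed

lemma L_smooth_lipschitz:
  assumes "L_smooth L f"
  shows "0 \<le> L" and "norm (gradient f x - gradient f y) \<le> L * norm (x - y)"
  using assms unfolding L_smooth_def lipschitz_on_def by (auto simp: dist_norm)

text \<open>The descent lemma: the Lipschitz bound makes \<open>\<phi>\<close> nonincreasing on the
  unit interval.\<close>

lemma L_smooth_upper_bound:
  fixes f :: "'a::euclidean_space \<Rightarrow> real"
  assumes "L_smooth L f"
  shows "f v \<le> f u + inner (gradient f u) (v - u) + L / 2 * (norm (v - u))\<^sup>2"
proof -
  define d where "d = v - u"
  define \<phi> where "\<phi> = (\<lambda>t. f (u + t *\<^sub>R d) - t * inner (gradient f u) d - L * t\<^sup>2 / 2 * (norm d)\<^sup>2)"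
  have deriv: "(\<phi> has_real_derivative
      inner d (gradient f (u + t *\<^sub>R d)) - inner (gradient f u) d - L * t * (norm d)\<^sup>2) (at t)" for t
  proof -
    have "((\<lambda>t. f (u + t *\<^sub>R d)) has_derivative (\<lambda>s. inner (s *\<^sub>R d) (gradient f (u + t *\<^sub>R d)))) (at t)"
      by (rule has_derivative_compose[OF _ L_smooth_has_derivative[OF assms]])
        (auto intro!: derivative_eq_intros)
    then have "((\<lambda>t. f (u + t *\<^sub>R d)) has_real_derivative inner d (gradient f (u + t *\<^sub>R d))) (at t)"
      unfolding has_field_derivative_def
      by (rule has_derivative_eq_rhs) (simp add: fun_eq_iff)
    then show ?thesis unfolding \<phi>_def by (auto intro!: derivative_eq_intros)
  qed
  have "\<phi> 1 \<le> \<phi> 0"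
  proof (rule DERIV_nonpos_imp_nonincreasing[where f = \<phi>])
    show "(0::real) \<le> 1" by simp
    fix t :: real assume t: "0 \<le> t" "t \<le> 1"
    have "inner d (gradient f (u + t *\<^sub>R d) - gradient f u)
        \<le> norm d * norm (gradient f (u + t *\<^sub>R d) - gradient f u)"
      by (rule norm_cauchy_schwarz)
    also have "\<dots> \<le> norm d * (L * norm (t *\<^sub>R d))"
      using L_smooth_lipschitz(2)[OF assms, of "u + t *\<^sub>R d" u] by (intro mult_left_mono) auto
    also have "\<dots> = L * t * (norm d)\<^sup>2" using t by (simp add: power2_eq_square)
    finally have "inner d (gradient f (u + t *\<^sub>R d)) - inner (gradient f u) d - L * t * (norm d)\<^sup>2 \<le> 0"
      by (simp add: inner_diff_right inner_commute)
    with deriv show "\<exists>y. DERIV \<phi> t :> y \<and> y \<le> 0" by blast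
  qed
  then show ?thesis unfolding \<phi>_def d_def by simp
qed

text \<open>The supergradient inequality at \<open>u - t d\<close> becomes, by convexity along the line through
  \<open>u\<close>, a lower bound at \<open>u + d\<close>; then \<open>t\<close> and \<open>\<epsilon>\<close> tend to \<open>0\<close>.\<close>

lemma supergradient_imp_lower_bound:
  fixes \<phi> :: "'a::real_inner \<Rightarrow> real"
  assumes conv: "convex_on UNIV (\<lambda>u. \<phi> u + s / 2 * (norm u)\<^sup>2)"
    and super: "\<And>\<epsilon>. 0 < \<epsilon> \<Longrightarrow>
      \<forall>\<^sub>F w in at u. \<phi> w \<le> \<phi> u + inner \<xi> (w - u) + \<epsilon> * norm (w - u)"
  shows "\<phi> u + inner \<xi> (v - u) - s / 2 * (norm (v - u))\<^sup>2 \<le> \<phi> v"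
proof (cases "v = u")
  case False
  define d where "d = v - u"
  have d: "d \<noteq> 0" "v = u + d" using False by (auto simp: d_def)
  have bound: "\<phi> u + inner \<xi> d - s / 2 * (norm d)\<^sup>2 \<le> \<phi> v + \<epsilon> * norm d" if "0 < \<epsilon>" for \<epsilon>
  proof -
    have "filterlim (\<lambda>t. u - t *\<^sub>R d) (nhds (u - 0 *\<^sub>R d)) (at_right (0::real))"
      by (intro tendsto_intros)
    moreover have "\<forall>\<^sub>F t in at_right (0::real). u - t *\<^sub>R d \<noteq> u"
      using eventually_at_right_less[of 0] by eventually_elim (use d in auto)
    ultimately have "filterlim (\<lambda>t. u - t *\<^sub>R d) (at u) (at_right (0::real))"
      by (simp add: filterlim_at)
    then have "\<forall>\<^sub>F t in at_right (0::real). \<phi> (u - t *\<^sub>R d)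
        \<le> \<phi> u + inner \<xi> (u - t *\<^sub>R d - u) + \<epsilon> * norm (u - t *\<^sub>R d - u)"
      by (rule eventually_compose_filterlim[OF super[OF that]])
    then have "\<forall>\<^sub>F t in at_right (0::real).
        \<phi> u + inner \<xi> d - s / 2 * (1 + t) * (norm d)\<^sup>2 \<le> \<phi> v + \<epsilon> * norm d"
      using eventually_at_right_less[of 0]
    proof eventually_elim
      case (elim t)
      define w where "w = u - t *\<^sub>R d"
      \<comment> \<open>\<open>u\<close> divides the segment from \<open>w\<close> to
        \<open>v\<close> in the ratio t : 1; the factor \<open>1 + t\<close> clears the
        weights.\<close>
      have "u = (1 - t / (1 + t)) *\<^sub>R w + (t / (1 + t)) *\<^sub>R v"
        unfolding w_def d(2) using elim
        by (simp add: algebra_simps divide_simps flip: scaleR_add_left)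
      moreover have "\<phi> ((1 - t / (1 + t)) *\<^sub>R w + (t / (1 + t)) *\<^sub>R v)
          + s / 2 * (norm ((1 - t / (1 + t)) *\<^sub>R w + (t / (1 + t)) *\<^sub>R v))\<^sup>2
          \<le> (1 - t / (1 + t)) * (\<phi> w + s / 2 * (norm w)\<^sup>2)
            + (t / (1 + t)) * (\<phi> v + s / 2 * (norm v)\<^sup>2)"
        using elim by (intro convex_onD[OF conv]) auto
      ultimately have "\<phi> u + s / 2 * (norm u)\<^sup>2
          \<le> (1 - t / (1 + t)) * (\<phi> w + s / 2 * (norm w)\<^sup>2)
            + (t / (1 + t)) * (\<phi> v + s / 2 * (norm v)\<^sup>2)" by simp
      moreover have "1 - t / (1 + t) = 1 / (1 + t)" using elim by (simp add: field_simps)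
      ultimately have "(1 + t) * (\<phi> u + s / 2 * (norm u)\<^sup>2)
          \<le> (\<phi> w + s / 2 * (norm w)\<^sup>2) + t * (\<phi> v + s / 2 * (norm v)\<^sup>2)"
        using elim by (simp add: divide_simps) (simp add: algebra_simps)
      \<comment> \<open>The terms linear in \<open>d\<close> cancel, so only a multiple of t remains
        and division by t is possible.\<close>
      moreover have "(norm w)\<^sup>2 + t * (norm v)\<^sup>2 = (1 + t) * (norm u)\<^sup>2 + t * (1 + t) * (norm d)\<^sup>2"
        unfolding w_def d(2) power2_norm_eq_inner
        by (simp add: inner_simps inner_commute algebra_simps)
      then have "s / 2 * ((norm w)\<^sup>2 + t * (norm v)\<^sup>2)
          = s / 2 * ((1 + t) * (norm u)\<^sup>2 + t * (1 + t) * (norm d)\<^sup>2)" by (rule arg_cong)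
      ultimately have "(1 + t) * \<phi> u \<le> \<phi> w + t * \<phi> v + s / 2 * t * (1 + t) * (norm d)\<^sup>2"
        by (simp add: algebra_simps add_divide_distrib)
      moreover have "\<phi> w \<le> \<phi> u - t * inner \<xi> d + \<epsilon> * (t * norm d)"
        using elim unfolding w_def by simp
      ultimately have "t * (\<phi> u + inner \<xi> d - s / 2 * (1 + t) * (norm d)\<^sup>2)
          \<le> t * (\<phi> v + \<epsilon> * norm d)"
        by (simp add: algebra_simps)
      then show ?case using elim by simp
    qed
    moreover have "((\<lambda>t. \<phi> u + inner \<xi> d - s / 2 * (1 + t) * (norm d)\<^sup>2)
        \<longlongrightarrow> \<phi> u + inner \<xi> d - s / 2 * (1 + 0) * (norm d)\<^sup>2) (at_right (0::real))"
      by (intro tendsto_intros)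
    ultimately show ?thesis
      using tendsto_upperbound[OF _ _ trivial_limit_at_right_real] by fastforce
  qed
  have "\<phi> u + inner \<xi> d - s / 2 * (norm d)\<^sup>2 \<le> \<phi> v"
  proof (rule field_le_epsilon)
    fix e :: real assume "0 < e"
    then show "\<phi> u + inner \<xi> d - s / 2 * (norm d)\<^sup>2 \<le> \<phi> v + e"
      using bound[of "e / norm d"] d(1) by simp
  qed
  then show ?thesis by (simp add: d_def)
qed simp

text \<open>\<open>s\<close> may be negative; the bound serves \<open>f\<close> with
  \<open>\<rho>_f\<close> and \<open>h\<close> with \<open>- \<sigma>_h\<close>. Differentiability
  supplies the supergradient inequality.\<close>

lemma L_smooth_lower_bound:
  fixes f :: "'a::euclidean_space \<Rightarrow> real"
  assumes "L_smooth L f" and "convex_on UNIV (\<lambda>u. f u + s / 2 * (norm u)\<^sup>2)"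
  shows "f u + inner (gradient f u) (v - u) - s / 2 * (norm (v - u))\<^sup>2 \<le> f v"
proof (rule supergradient_imp_lower_bound[OF assms(2)])
  fix \<epsilon> :: real assume "0 < \<epsilon>"
  with L_smooth_has_derivative[OF assms(1), of u]
  obtain \<delta> where "0 < \<delta>" and \<delta>: "\<And>w. norm (w - u) < \<delta> \<Longrightarrow>
      norm (f w - f u - inner (w - u) (gradient f u)) \<le> \<epsilon> * norm (w - u)"
    unfolding has_derivative_at_alt by blast
  have "\<forall>\<^sub>F w in at u. norm (w - u) < \<delta>"
    using \<open>0 < \<delta>\<close> unfolding eventually_at by (auto simp: dist_norm)
  then show "\<forall>\<^sub>F w in at u. f w \<le> f u + inner (gradient f u) (w - u) + \<epsilon> * norm (w - u)"
  proof eventually_elim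
    case (elim w)
    show ?case using \<delta>[OF elim] by (simp add: inner_commute abs_le_iff)
  qed
qed

text \<open>The negative of a regular subgradient of \<open>p\<close> is a supergradient of
  \<open>- p\<close> up to \<open>\<epsilon>\<close>, which weak convexity turns into a global
  bound. The inequality passes to the limit since the values of \<open>p\<close> converge along the
  sequence.\<close>

lemma limiting_subdiff_upper_bound:
  fixes p :: "'a::real_inner \<Rightarrow> real"
  assumes "weakly_convex \<rho> (\<lambda>u. - p u)" and "\<xi> \<in> limiting_subdiff p u"
  shows "p v \<le> p u + inner \<xi> (v - u) + \<rho> / 2 * (norm (v - u))\<^sup>2"
proof -
  have regular: "p v \<le> p w + inner \<zeta> (v - w) + \<rho> / 2 * (norm (v - w))\<^sup>2"
    if "\<zeta> \<in> regular_subdiff p w" for w \<zeta>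
  proof -
    have "- p w + inner (- \<zeta>) (v - w) - \<rho> / 2 * (norm (v - w))\<^sup>2 \<le> - p v"
    proof (rule supergradient_imp_lower_bound)
      show "convex_on UNIV (\<lambda>u. - p u + \<rho> / 2 * (norm u)\<^sup>2)"
        using assms(1) unfolding weakly_convex_def by simp
      fix \<epsilon> :: real assume "0 < \<epsilon>"
      then have "ereal (- \<epsilon>) < 0" by simp
      then have "\<forall>\<^sub>F t in at w. ereal (- \<epsilon>) < ereal ((p t - p w - inner \<zeta> (t - w)) / norm (t - w))"
        using that unfolding regular_subdiff_def mem_Collect_eq le_Liminf_iff by blast
      moreover have "\<forall>\<^sub>F t in at w. t \<noteq> w" by (simp add: eventually_at_filter)
      ultimately show "\<forall>\<^sub>F t in at w. - p t \<le> - p w + inner (- \<zeta>) (t - w) + \<epsilon> * norm (t - w)"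
      proof eventually_elim
        case (elim t)
        then have "- \<epsilon> * norm (t - w) < p t - p w - inner \<zeta> (t - w)"
          by (simp add: less_divide_eq)
        then show ?case by (simp add: inner_simps)
      qed
    qed
    then show ?thesis by simp
  qed
  from assms(2) obtain X \<Xi> where "X \<longlonglongrightarrow> u" "(\<lambda>k. p (X k)) \<longlonglongrightarrow> p u" "\<Xi> \<longlonglongrightarrow> \<xi>"
    "\<And>k. \<Xi> k \<in> regular_subdiff p (X k)"
    unfolding limiting_subdiff_def by blast
  then have "(\<lambda>k. p (X k) + inner (\<Xi> k) (v - X k) + \<rho> / 2 * (norm (v - X k))\<^sup>2)
      \<longlonglongrightarrow> p u + inner \<xi> (v - u) + \<rho> / 2 * (norm (v - u))\<^sup>2"
    by (intro tendsto_intros)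
  then show ?thesis
    by (rule tendsto_lowerbound) (use \<open>\<And>k. \<Xi> k \<in> _\<close> regular in auto)
qed

section \<open>Cocoercivity under weak convexity\<close>

text \<open>With \<open>G\<close> as gradient, the gap between \<open>\<phi>\<close> and its lower
  model at \<open>u\<close> is nonnegative and has gradient \<open>r\<close> at \<open>v\<close>.
  The claim is its nonnegativity after a gradient step of size \<open>1 / (L + \<rho>)\<close> from
  \<open>v\<close>.\<close>

lemma cocoercive_lower_bound:
  fixes \<phi> :: "'a::real_inner \<Rightarrow> real"
  assumes lower: "\<And>u v. \<phi> u + inner (G u) (v - u) - \<rho> / 2 * (norm (v - u))\<^sup>2 \<le> \<phi> v"
    and upper: "\<And>u v. \<phi> v \<le> \<phi> u + inner (G u) (v - u) + L / 2 * (norm (v - u))\<^sup>2"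
    and "0 < L + \<rho>"
  shows "\<phi> u + inner (G u) (v - u) - \<rho> / 2 * (norm (v - u))\<^sup>2
      + (norm (G v - G u + \<rho> *\<^sub>R (v - u)))\<^sup>2 / (2 * (L + \<rho>)) \<le> \<phi> v"
proof -
  define d where "d = v - u"
  define r where "r = G v - G u + \<rho> *\<^sub>R d"
  define m where "m = 1 / (L + \<rho>)"
  define w where "w = v - m *\<^sub>R r"
  have Gv: "G v = r + G u - \<rho> *\<^sub>R d" by (simp add: r_def)
  have "\<phi> u + inner (G u) (w - u) - \<rho> / 2 * (norm (w - u))\<^sup>2
      \<le> \<phi> v + inner (G v) (w - v) + L / 2 * (norm (w - v))\<^sup>2"
    using lower[of u w] upper[of w v] by linarith
  moreover have "w - u = d - m *\<^sub>R r" "w - v = - (m *\<^sub>R r)" by (simp_all add: w_def d_def)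
  ultimately have "\<phi> u + inner (G u) d - \<rho> / 2 * inner d d
      + m * inner r r - (L + \<rho>) * m * (m * inner r r) / 2 \<le> \<phi> v"
    unfolding power2_norm_eq_inner Gv by (simp add: inner_simps inner_commute algebra_simps add_divide_distrib)
  moreover have "(L + \<rho>) * m = 1" using assms(3) by (simp add: m_def)
  ultimately have "\<phi> u + inner (G u) d - \<rho> / 2 * inner d d + m * inner r r / 2 \<le> \<phi> v"
    by simp
  then show ?thesis unfolding r_def d_def m_def power2_norm_eq_inner by (simp add: mult.commute)
qed

text \<open>One order of \<open>u\<close>, \<open>v\<close> leaves a term in \<open>c\<close> of
  unknown sign; using both orders bounds \<open>c\<close> from below.\<close>

lemma hypoconvex_cocoercive_bound:
  fixes \<phi> :: "'a::real_inner \<Rightarrow> real"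
  assumes lower: "\<And>u v. \<phi> u + inner (G u) (v - u) - \<rho> / 2 * (norm (v - u))\<^sup>2 \<le> \<phi> v"
    and upper: "\<And>u v. \<phi> v \<le> \<phi> u + inner (G u) (v - u) + L / 2 * (norm (v - u))\<^sup>2"
    and "0 \<le> \<rho>" and "0 < \<eta>" and "L - \<rho> \<le> \<eta>"
  shows "(norm (G v - G u))\<^sup>2 / (2 * \<eta>) - \<rho> * (\<eta> + \<rho>) / (2 * \<eta>) * (norm (v - u))\<^sup>2
      \<le> \<phi> v - \<phi> u - inner (G u) (v - u)"
proof -
  define d where "d = v - u"
  define e where "e = G v - G u"
  \<comment> \<open>\<open>M\<close> is the sum of \<open>\<rho>\<close> and the upper curvature
    constant, enlarged from \<open>L\<close> to \<open>\<eta> + \<rho>\<close>.\<close>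
  define M where "M = \<eta> + 2 * \<rho>"
  have M: "0 < M" using assms(3,4) by (simp add: M_def)
  have upper': "\<phi> v \<le> \<phi> u + inner (G u) (v - u) + (\<eta> + \<rho>) / 2 * (norm (v - u))\<^sup>2" for u v
  proof -
    have "L / 2 * (norm (v - u))\<^sup>2 \<le> (\<eta> + \<rho>) / 2 * (norm (v - u))\<^sup>2"
      using assms(5) by (intro mult_right_mono) auto
    then show ?thesis using upper[of v u] by linarith
  qed
  have coco: "\<phi> u + inner (G u) (v - u) - \<rho> / 2 * (norm (v - u))\<^sup>2
      + (norm (G v - G u + \<rho> *\<^sub>R (v - u)))\<^sup>2 / (2 * M) \<le> \<phi> v" for u v
    using cocoercive_lower_bound[OF lower upper', of u v] M by (simp add: M_def add_ac)
  define T where "T = \<phi> v - \<phi> u - inner (G u) d"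
  have "inner (G v) (u - v) = - inner (G u) d - inner e d"
    by (simp add: d_def e_def inner_simps)
  moreover have "norm (G u - G v + \<rho> *\<^sub>R (u - v)) = norm (e + \<rho> *\<^sub>R d)"
    using norm_minus_cancel[of "e + \<rho> *\<^sub>R d"] by (simp add: d_def e_def algebra_simps)
  ultimately have 1: "(norm (e + \<rho> *\<^sub>R d))\<^sup>2 / (2 * M) \<le> T + \<rho> / 2 * (norm d)\<^sup>2"
    and 2: "(norm (e + \<rho> *\<^sub>R d))\<^sup>2 / (2 * M) \<le> inner e d - T + \<rho> / 2 * (norm d)\<^sup>2"
    using coco[of u v] coco[of v u] norm_minus_commute[of u v]
    unfolding T_def d_def e_def by simp_all
  define a b c where "a = (norm d)\<^sup>2" and "b = (norm e)\<^sup>2" and "c = inner e d"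
  have n: "(norm (e + \<rho> *\<^sub>R d))\<^sup>2 = b + 2 * \<rho> * c + \<rho>\<^sup>2 * a"
    unfolding a_def b_def c_def power2_norm_eq_inner
    by (simp add: inner_simps inner_commute algebra_simps power2_eq_square)
  have 3: "b + 2 * \<rho> * c + \<rho>\<^sup>2 * a \<le> M * (2 * T + \<rho> * a)"
    and "b + 2 * \<rho> * c + \<rho>\<^sup>2 * a \<le> M * (2 * c - 2 * T + \<rho> * a)"
    using 1 2 M unfolding n a_def[symmetric] c_def[symmetric] by (simp_all add: field_simps)
  then have "2 * (b + 2 * \<rho> * c + \<rho>\<^sup>2 * a) \<le> M * (2 * c + 2 * \<rho> * a)"
    by (simp add: algebra_simps)
  then have "b - \<rho> * (\<eta> + \<rho>) * a \<le> \<eta> * c"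
    by (simp add: M_def algebra_simps power2_eq_square)
  \<comment> \<open>With weights \<open>2 * \<rho>\<close> here and \<open>\<eta>\<close> below, the
    multiples of \<open>c\<close> cancel and \<open>M\<close> factors out.\<close>
  then have "2 * \<rho> * (b - \<rho> * (\<eta> + \<rho>) * a) \<le> 2 * \<rho> * (\<eta> * c)"
    using assms(3) by (intro mult_left_mono) auto
  moreover have "\<eta> * (b + 2 * \<rho> * c + \<rho>\<^sup>2 * a) \<le> \<eta> * (M * (2 * T + \<rho> * a))"
    using 3 assms(4) by (intro mult_left_mono) auto
  ultimately have "M * (b - \<rho> * (\<eta> + \<rho>) * a) \<le> M * (2 * \<eta> * T)"
    by (simp add: M_def algebra_simps power2_eq_square)
  then have "b - \<rho> * (\<eta> + \<rho>) * a \<le> 2 * \<eta> * T" using M by simp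
  then have "b / (2 * \<eta>) - \<rho> * (\<eta> + \<rho>) / (2 * \<eta>) * a \<le> T"
    using assms(4) by (simp add: field_simps)
  then show ?thesis by (simp add: a_def b_def T_def d_def e_def)
qed

section \<open>The step size bound\<close>

text \<open>The product of the roots is \<open>- c / a \<le> 0\<close>. In the factorization at the
  root \<open>r\<close>, the second factor is positive because
  \<open>r * (a * r + b) = c \<ge> 0\<close>. For \<open>c = 0\<close> the condition
  \<open>b < 0\<close> keeps \<open>r\<close> away from 0.\<close>

lemma positive_root_quadratic:
  fixes a b c :: real
  assumes q: "\<And>t. q t = a * t\<^sup>2 + b * t - c"
    and "0 < a" and "0 \<le> c" and "0 < c \<or> b < 0"
  shows "0 < positive_root q" and "q (positive_root q) = 0"
    and "\<And>t. 0 < t \<Longrightarrow> q t < 0 \<longleftrightarrow> t < positive_root q"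
    and "\<And>t. 0 < t \<Longrightarrow> 0 < q t \<longleftrightarrow> positive_root q < t"
proof -
  define D where "D = b\<^sup>2 + 4 * a * c"
  define r where "r = (sqrt D - b) / (2 * a)"
  have "0 \<le> D" using assms(2,3) by (simp add: D_def)
  have "b < sqrt D"
  proof (cases "b < 0")
    case False
    then have "b\<^sup>2 < D" using assms by (simp add: D_def)
    then show ?thesis by (simp add: real_less_rsqrt)
  qed (use \<open>0 \<le> D\<close> in \<open>auto intro: less_le_trans\<close>)
  then have r: "0 < r" using assms(2) by (simp add: r_def)
  have "2 * a * r + b = sqrt D" using assms(2) by (simp add: r_def)
  then have "(2 * a * r + b)\<^sup>2 = D" using \<open>0 \<le> D\<close> by simp
  then have "4 * a * (a * r\<^sup>2 + b * r - c) = 0"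
    by (simp add: D_def power2_eq_square algebra_simps)
  then have qr: "a * r\<^sup>2 + b * r - c = 0" using assms(2) by simp
  have "r * (a * r + b) = c" using qr by (simp add: power2_eq_square algebra_simps)
  then have "0 \<le> a * r + b" using r assms(3) by (metis zero_le_mult_iff not_less)
  then have slope: "0 < a * (t + r) + b" if "0 < t" for t
    using mult_pos_pos[OF assms(2) that] by (simp add: algebra_simps)
  have factor: "q t = (t - r) * (a * (t + r) + b)" for t
    using qr unfolding q by (simp add: power2_eq_square algebra_simps)
  have sgn: "q t < 0 \<longleftrightarrow> t < r" "0 < q t \<longleftrightarrow> r < t" "q t = 0 \<longleftrightarrow> t = r" if "0 < t" for t
    using slope[OF that] unfolding factor by (auto simp: mult_less_0_iff zero_less_mult_iff)
  have "positive_root q = r"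
    unfolding positive_root_def by (rule the_equality) (use r sgn in auto)
  then show "0 < positive_root q" "q (positive_root q) = 0"
    "\<And>t. 0 < t \<Longrightarrow> q t < 0 \<longleftrightarrow> t < positive_root q"
    "\<And>t. 0 < t \<Longrightarrow> 0 < q t \<longleftrightarrow> positive_root q < t"
    using r sgn by auto
qed

text \<open>Divided by t, the quadratic is \<open>A * t + B - C / t\<close>, increasing in t > 0.
  \<open>A = 0\<close> is allowed because \<open>L_f * L_h\<close> may vanish.\<close>

lemma quadratic_neg_below:
  fixes A B C t s :: real
  assumes "0 \<le> A" "0 < C" "0 < t" "t < s" "A * s\<^sup>2 + B * s - C \<le> 0"
  shows "A * t\<^sup>2 + B * t - C < 0"
proof -
  have "A * t \<le> A * s" using assms by (intro mult_left_mono) auto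
  then have "t * (A * t + B) \<le> t * (A * s + B)" using assms by (intro mult_left_mono) auto
  moreover have "s * (t * (A * s + B)) \<le> t * C"
    using mult_left_mono[OF assms(5), of t] assms(3) by (simp add: power2_eq_square algebra_simps)
  moreover have "t * C < s * C" using assms by simp
  ultimately have "s * (t * (A * t + B)) < s * C"
    using assms mult_left_mono[of "t * (A * t + B)" "t * (A * s + B)" s] by linarith
  then have "t * (A * t + B) < C" using assms by simp
  then show ?thesis by (simp add: power2_eq_square algebra_simps)
qed

lemma poly_q_conv_poly_c2:
  assumes "0 < \<eta>"
  shows "poly_q \<tau> L_f L_h \<rho> \<sigma> \<eta> = - 2 * \<eta>\<^sup>2 * poly_c2 \<tau> L_f L_h \<rho> \<sigma> \<eta> (\<tau> / (2 * \<eta>))"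
  using assms unfolding poly_q_def poly_c2_def by (simp add: field_simps power2_eq_square)

text \<open>At \<open>2 * a * (L_f - \<rho>) = \<tau>\<close> the |e|^2 terms cancel exactly for
  \<open>\<eta> = L_f - \<rho>\<close>, so dropping them and estimating them give the same
  coefficient.\<close>

lemma poly_c1_conv_poly_c2:
  assumes "\<rho> < L_f" and "a = \<tau> / (2 * (L_f - \<rho>))"
  shows "poly_c1 \<tau> L_f L_h \<sigma> a = poly_c2 \<tau> L_f L_h \<rho> \<sigma> (L_f - \<rho>) a"
proof -
  define \<delta> where "\<delta> = L_f - \<rho>"
  have "\<delta> > 0" "L_f = \<delta> + \<rho>" using assms by (auto simp: \<delta>_def)
  then have "\<tau> = 2 * \<delta> * a" using assms(2) by simp
  have "2 * L_f\<^sup>2 * a - \<tau> * L_f = \<rho> * \<tau> * (\<delta> + \<rho>) / \<delta>"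
    unfolding \<open>\<tau> = _\<close> \<open>L_f = _\<close> using \<open>\<delta> > 0\<close> by (simp add: field_simps power2_eq_square)
  then have "(2 * L_f\<^sup>2 * a - \<tau> * L_f) * a = \<rho> * \<tau> * (\<delta> + \<rho>) / \<delta> * a" by simp
  then show ?thesis unfolding poly_c1_def poly_c2_def \<delta>_def[symmetric]
    by (simp add: algebra_simps power2_eq_square)
qed

text \<open>The disjunction separates the steps for which |e|^2 is estimated from those for which it
  is dropped. Its \<open>\<eta>\<close> is \<open>L_f - \<rho>\<close> for small steps in the first
  case of \<open>alpha_bar\<close> and the root of \<open>poly_q\<close> in the second.\<close>

lemma coeff_c_cases:
  assumes "0 \<le> \<rho>" "\<rho> \<le> L_f" "0 \<le> L_h" "0 < L_f + L_h" "\<sigma> \<le> L_h" "1 < \<tau>" "\<tau> < 2"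
    and "0 < a" "a \<le> alpha_bar \<tau> L_f L_h \<rho> \<sigma>"
  shows "(\<rho> < L_f \<and> \<tau> \<le> 2 * a * (L_f - \<rho>) \<and>
            coeff_c \<tau> L_f L_h \<rho> \<sigma> a = poly_c1 \<tau> L_f L_h \<sigma> a) \<or>
         (\<exists>\<eta>>0. L_f - \<rho> \<le> \<eta> \<and> 2 * a * \<eta> \<le> \<tau> \<and>
            coeff_c \<tau> L_f L_h \<rho> \<sigma> a = poly_c2 \<tau> L_f L_h \<rho> \<sigma> \<eta> a)" (is ?cases)
    and "coeff_c \<tau> L_f L_h \<rho> \<sigma> a \<le> 0"
    and "a < alpha_bar \<tau> L_f L_h \<rho> \<sigma> \<Longrightarrow> coeff_c \<tau> L_f L_h \<rho> \<sigma> a < 0"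
proof -
  let ?c1 = "poly_c1 \<tau> L_f L_h \<sigma>" and ?c2 = "poly_c2 \<tau> L_f L_h \<rho> \<sigma>"
  let ?q = "poly_q \<tau> L_f L_h \<rho> \<sigma>" and ?c = "coeff_c \<tau> L_f L_h \<rho> \<sigma> a"
  define \<alpha>1 where "\<alpha>1 = positive_root ?c1"
  define \<eta> where "\<eta> = positive_root ?q"
  define \<delta> where "\<delta> = L_f - \<rho>"
  have "0 \<le> \<delta>" "0 \<le> L_f" using assms by (auto simp: \<delta>_def)
  \<comment> \<open>If \<open>L_f = 0\<close>, then \<open>\<delta> = 0\<close>, and the test
    \<open>\<tau> \<le> 2 * \<alpha>1 * \<delta>\<close> fails whatever \<open>\<alpha>1\<close>
    is.\<close>
  have root1: "0 < \<alpha>1" "?c1 \<alpha>1 = 0" "\<And>t. 0 < t \<Longrightarrow> ?c1 t < 0 \<longleftrightarrow> t < \<alpha>1"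
    "\<And>t. 0 < t \<Longrightarrow> 0 < ?c1 t \<longleftrightarrow> \<alpha>1 < t" if "0 < L_f"
  proof -
    have "0 < 2 * L_f * (L_f + L_h)" "0 \<le> 2 - \<tau>" "0 < 2 - \<tau> \<or> \<tau> * L_h - 2 * (\<tau> - 1) * \<sigma> - \<tau> * L_f < 0"
      using that assms(4,7) by simp_all
    note root = positive_root_quadratic[OF poly_c1_def this, folded \<alpha>1_def]
    show "0 < \<alpha>1" "?c1 \<alpha>1 = 0" "\<And>t. 0 < t \<Longrightarrow> ?c1 t < 0 \<longleftrightarrow> t < \<alpha>1"
      "\<And>t. 0 < t \<Longrightarrow> 0 < ?c1 t \<longleftrightarrow> \<alpha>1 < t"
      by (fact root)+
  qed
  have c2_neg: "?c2 \<zeta> t < 0" if "0 < t" "t < s" "?c2 \<zeta> s \<le> 0" for \<zeta> t s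
    using quadratic_neg_below[of "2 * L_f * L_h" "2 - \<tau>" t s] that assms(3,7) \<open>0 \<le> L_f\<close>
    unfolding poly_c2_def by simp
  have "?cases \<and> ?c \<le> 0 \<and> (a < alpha_bar \<tau> L_f L_h \<rho> \<sigma> \<longrightarrow> ?c < 0)"
  proof (cases "\<tau> \<le> 2 * \<alpha>1 * \<delta>")
    case True
    then have "\<delta> \<noteq> 0" using assms by auto
    then have \<delta>: "0 < \<delta>" "\<rho> < L_f" "0 < L_f" using \<open>0 \<le> \<delta>\<close> assms by (auto simp: \<delta>_def)
    have ab: "alpha_bar \<tau> L_f L_h \<rho> \<sigma> = \<alpha>1"
      using True unfolding alpha_bar_def Let_def \<alpha>1_def \<delta>_def by simp
    show ?thesis
    proof (cases "\<tau> \<le> 2 * a * \<delta>")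
      case t: True
      then have c: "?c = ?c1 a"
        using True unfolding coeff_c_def Let_def \<alpha>1_def \<delta>_def by simp
      have "?c1 a < 0" if "a < \<alpha>1" using root1(3)[OF \<delta>(3)] that assms by blast
      moreover have "?c1 a \<le> 0"
        using calculation root1(2)[OF \<delta>(3)] assms(9) unfolding ab by (cases "a = \<alpha>1") auto
      ultimately show ?thesis using c t \<delta> unfolding ab \<delta>_def by simp
    next
      case t: False
      then have c: "?c = ?c2 \<delta> a"
        using True unfolding coeff_c_def Let_def \<alpha>1_def \<delta>_def by simp
      \<comment> \<open>At the threshold \<open>s\<close> both polynomials agree; since
        \<open>s \<le> \<alpha>1\<close>, the sign of \<open>poly_c1\<close> passes to
        \<open>poly_c2\<close> and from \<open>s\<close> down to \<open>a\<close>.\<close>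
      define s where "s = \<tau> / (2 * \<delta>)"
      have s: "0 < s" "a < s" "s \<le> \<alpha>1" using t True \<delta>(1) assms(6) by (simp_all add: s_def field_simps)
      have "?c1 s \<le> 0" using root1(2,3)[OF \<delta>(3)] s by (cases "s = \<alpha>1") (auto simp: less_imp_le)
      then have "?c2 \<delta> s \<le> 0" using poly_c1_conv_poly_c2[OF \<delta>(2), of s \<tau> L_h \<sigma>]
        unfolding s_def \<delta>_def by simp
      then have "?c2 \<delta> a < 0" using c2_neg s assms by blast
      then show ?thesis using c t \<delta>
        by (auto intro!: disjI2 exI[of _ \<delta>] simp: \<delta>_def)
    qed
  next
    case False
    have ab: "alpha_bar \<tau> L_f L_h \<rho> \<sigma> = \<tau> / (2 * \<eta>)"
      using False unfolding alpha_bar_def Let_def \<alpha>1_def \<delta>_def \<eta>_def by simp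
    have c: "?c = ?c2 \<eta> a"
      using False unfolding coeff_c_def Let_def \<alpha>1_def \<delta>_def \<eta>_def by simp
    define B where "B = \<tau> * L_h - 2 * (\<tau> - 1) * \<sigma> + \<rho> * \<tau>"
    define C where "C = \<tau>\<^sup>2 * (\<rho>\<^sup>2 + L_f * L_h)"
    have q: "?q t = 2 * (2 - \<tau>) * t\<^sup>2 + (- (\<tau> * B)) * t - C" for t
      unfolding poly_q_def B_def C_def by simp
    have "0 \<le> C" using assms \<open>0 \<le> L_f\<close> by (simp add: C_def)
    \<comment> \<open>Here the threshold lies above \<open>\<alpha>1\<close>, so
      \<open>poly_c1\<close> is positive there, which the two conversions turn into the sign of
      \<open>?q \<delta>\<close>. This later gives \<open>\<delta> \<le> \<eta>\<close>.\<close>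
    have q\<delta>: "?q \<delta> < 0" if "0 < \<delta>"
    proof -
      have L: "0 < L_f" "\<rho> < L_f" using that assms by (auto simp: \<delta>_def)
      define s where "s = \<tau> / (2 * \<delta>)"
      have s: "0 < s" "\<alpha>1 < s" using False that assms(6) by (simp_all add: s_def field_simps)
      then have "0 < ?c1 s"
        using root1(4)[OF L(1)] by simp
      then show ?thesis
        using poly_q_conv_poly_c2[OF that, of \<tau> L_f L_h \<rho> \<sigma>]
          poly_c1_conv_poly_c2[OF L(2), of s \<tau> L_h \<sigma>] that
        unfolding s_def \<delta>_def by (simp add: mult_pos_pos)
    qed
    \<comment> \<open>This yields the positive root of \<open>?q\<close>. For
      \<open>0 < \<delta>\<close> it follows from \<open>?q \<delta> < 0\<close>. If
      \<open>\<rho> = L_f\<close>, then \<open>C > 0\<close> when \<open>L_f > 0\<close>; otherwise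
      \<open>L_h > 0\<close> and \<open>\<sigma> \<le> L_h\<close> give
      \<open>B > 0\<close>.\<close>
    have "0 < C \<or> - (\<tau> * B) < 0"
    proof (cases "0 < \<delta>")
      case True
      have "0 \<le> 2 * (2 - \<tau>) * \<delta>\<^sup>2" using assms by simp
      then have "- (\<tau> * B) * \<delta> - C < 0" using q\<delta>[OF True] unfolding q by linarith
      then show ?thesis using \<open>0 \<le> C\<close> True
        by (metis diff_0_right le_less less_imp_not_less linorder_not_less mult_nonneg_nonneg)
    next
      case False
      then have "\<rho> = L_f" using \<open>0 \<le> \<delta>\<close> by (simp add: \<delta>_def)
      show ?thesis
      proof (cases "L_f = 0")
        case True
        then have "0 < L_h" using assms by simp
        have "(\<tau> - 1) * \<sigma> \<le> (\<tau> - 1) * L_h" using assms by (intro mult_left_mono) auto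
        then have "(2 - \<tau>) * L_h \<le> B" using True \<open>\<rho> = L_f\<close> by (simp add: B_def algebra_simps)
        moreover have "0 < (2 - \<tau>) * L_h" using assms \<open>0 < L_h\<close> by simp
        ultimately show ?thesis using assms by simp
      next
        case False
        then have "0 < C" using assms(3,6) \<open>\<rho> = L_f\<close> \<open>0 \<le> L_f\<close>
          unfolding C_def by (intro mult_pos_pos add_pos_nonneg) simp_all
        then show ?thesis by simp
      qed
    qed
    moreover have "0 < 2 * (2 - \<tau>)" using assms(7) by simp
    ultimately have \<eta>: "0 < \<eta>" "?q \<eta> = 0" "\<And>t. 0 < t \<Longrightarrow> ?q t < 0 \<longleftrightarrow> t < \<eta>"
      unfolding \<eta>_def using positive_root_quadratic[OF q _ \<open>0 \<le> C\<close>] by blast+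
    have "\<delta> \<le> \<eta>" using \<eta>(1) \<eta>(3)[of \<delta>] q\<delta> by (cases "0 < \<delta>") auto
    moreover have "2 * a * \<eta> \<le> \<tau>" using assms(9) \<eta>(1) unfolding ab by (simp add: field_simps)
    moreover have root: "?c2 \<eta> (\<tau> / (2 * \<eta>)) = 0"
      using poly_q_conv_poly_c2[OF \<eta>(1), of \<tau> L_f L_h \<rho> \<sigma>] \<eta> by simp
    have "?c2 \<eta> a < 0" if "a < \<tau> / (2 * \<eta>)" using c2_neg[OF assms(8) that] root by simp
    moreover have "?c2 \<eta> a \<le> 0"
      using calculation(3) root assms(9) unfolding ab by (cases "a = \<tau> / (2 * \<eta>)") auto
    ultimately show ?thesis using c \<eta>(1) unfolding ab \<delta>_def by auto
  qed
  then show ?cases "?c \<le> 0" "a < alpha_bar \<tau> L_f L_h \<rho> \<sigma> \<Longrightarrow> ?c < 0" by auto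
qed

section \<open>Descent of the merit function\<close>

lemma L_smooth_descent_gap:
  fixes f :: "'a::euclidean_space \<Rightarrow> real" and a :: real
  assumes f: "L_smooth L f" and wc: "weakly_convex \<rho> f" and "0 < \<tau>"
  defines "gap \<equiv> \<lambda>u v. f v - f u - inner (gradient f u) (v - u)
      - a / \<tau> * (norm (gradient f v - gradient f u))\<^sup>2"
  shows "0 < \<eta> \<Longrightarrow> L - \<rho> \<le> \<eta> \<Longrightarrow> 2 * a * \<eta> \<le> \<tau> \<Longrightarrow>
      - (\<rho> * (\<eta> + \<rho>) / (2 * \<eta>)) * (norm (v - u))\<^sup>2 \<le> gap u v"
    and "\<rho> < L \<Longrightarrow> \<tau> \<le> 2 * a * (L - \<rho>) \<Longrightarrow>
      (L / 2 - a * L\<^sup>2 / \<tau>) * (norm (v - u))\<^sup>2 \<le> gap u v"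
proof -
  have \<rho>: "0 \<le> \<rho>" and conv: "convex_on UNIV (\<lambda>u. f u + \<rho> / 2 * (norm u)\<^sup>2)"
    using wc unfolding weakly_convex_def by auto
  define E where "E = (norm (gradient f v - gradient f u))\<^sup>2"
  define T where "T = f v - f u - inner (gradient f u) (v - u)"
  have gap: "gap u v = T - a / \<tau> * E" unfolding gap_def E_def T_def by simp
  have "0 \<le> E" by (simp add: E_def)
  have bound: "E / (2 * \<eta>) - \<rho> * (\<eta> + \<rho>) / (2 * \<eta>) * (norm (v - u))\<^sup>2 \<le> T"
    if "0 < \<eta>" "L - \<rho> \<le> \<eta>" for \<eta>
    using hypoconvex_cocoercive_bound[OF L_smooth_lower_bound[OF f conv] L_smooth_upper_bound[OF f] \<rho> that]
    unfolding E_def T_def by simp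
  {
    assume \<eta>: "0 < \<eta>" "L - \<rho> \<le> \<eta>" "2 * a * \<eta> \<le> \<tau>"
    have "a / \<tau> \<le> 1 / (2 * \<eta>)" using \<eta> assms by (simp add: field_simps)
    then have "a / \<tau> * E \<le> 1 / (2 * \<eta>) * E" using \<open>0 \<le> E\<close> by (rule mult_right_mono)
    then show "- (\<rho> * (\<eta> + \<rho>) / (2 * \<eta>)) * (norm (v - u))\<^sup>2 \<le> gap u v"
      unfolding gap using bound[OF \<eta>(1,2)] by simp
  next
    assume L: "\<rho> < L" "\<tau> \<le> 2 * a * (L - \<rho>)"
    \<comment> \<open>Among the admissible \<open>\<eta>\<close>, the smallest one,
      \<open>\<delta>\<close>, minimizes the deficit \<open>a / \<tau> - 1 / (2 * \<eta>)\<close>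
      that the Lipschitz bound must cover.\<close>
    define \<delta> where "\<delta> = L - \<rho>"
    have \<delta>: "0 < \<delta>" "L = \<delta> + \<rho>" using L by (auto simp: \<delta>_def)
    have "1 / (2 * \<delta>) \<le> a / \<tau>" using L \<delta> assms by (simp add: field_simps)
    moreover have "E \<le> (L * norm (v - u))\<^sup>2"
      unfolding E_def using L_smooth_lipschitz(2)[OF f] by (intro power_mono) auto
    ultimately have "(a / \<tau> - 1 / (2 * \<delta>)) * E \<le> (a / \<tau> - 1 / (2 * \<delta>)) * (L * norm (v - u))\<^sup>2"
      by (intro mult_left_mono) auto
    moreover have "E / (2 * \<delta>) - \<rho> * L / (2 * \<delta>) * (norm (v - u))\<^sup>2 \<le> T"
      using bound[of \<delta>] \<delta> by simp
    \<comment> \<open>The terms with \<open>1 / (2 * \<delta>)\<close> combine to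
      \<open>L * (L - \<rho>) / (2 * \<delta>) = L / 2\<close>, so \<open>\<rho>\<close>
      disappears.\<close>
    moreover have "(L / 2 - a * L\<^sup>2 / \<tau>) * (norm (v - u))\<^sup>2
        = - (a / \<tau> - 1 / (2 * \<delta>)) * (L * norm (v - u))\<^sup>2 - \<rho> * L / (2 * \<delta>) * (norm (v - u))\<^sup>2"
    proof -
      have "L / 2 - a * L\<^sup>2 / \<tau> = - (a / \<tau> - 1 / (2 * \<delta>)) * L\<^sup>2 - \<rho> * L / (2 * \<delta>)"
        unfolding \<delta>(2) using \<delta>(1) assms(3) by (simp add: field_simps power2_eq_square)
      then show ?thesis by (simp only: power_mult_distrib left_diff_distrib mult.assoc)
    qed
    ultimately show "(L / 2 - a * L\<^sup>2 / \<tau>) * (norm (v - u))\<^sup>2 \<le> gap u v"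
      unfolding gap by (simp add: algebra_simps)
  }
qed

text \<open>Applied with \<open>u\<close>, \<open>v\<close> the iterates \<open>x k\<close>, \<open>x (k - 1)\<close> and \<open>s = y k - x (k - 1)\<close>, which
  is the step \<open>(z k - z (k - 1)) / \<tau>\<close>.\<close>

lemma model_decrease:
  fixes f h :: "'a::euclidean_space \<Rightarrow> real"
  assumes f: "L_smooth L_f f" and h: "L_smooth L_h h"
    and conv: "convex_on UNIV (\<lambda>u. h u - \<sigma> / 2 * (norm u)\<^sup>2)"
    and "1 < \<tau>" and "0 < a"
    and s: "\<tau> *\<^sub>R s = (u + a *\<^sub>R gradient f u) - (v + a *\<^sub>R gradient f v)"
    and gap: "- K * (norm (v - u))\<^sup>2 \<le> f v - f u - inner (gradient f u) (v - u)
      - a / \<tau> * (norm (gradient f v - gradient f u))\<^sup>2"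
  shows "- (2 * L_f * L_h * a\<^sup>2 + (\<tau> * L_h - 2 * (\<tau> - 1) * \<sigma> + 2 * \<tau> * K) * a - (2 - \<tau>))
        / (2 * \<tau> * a) * (norm (u - v))\<^sup>2
    \<le> (f v + h v + inner (gradient f v + gradient h v) s + 1 / (2 * a) * (norm s)\<^sup>2)
      - (f u + h u + inner (gradient f u + gradient h u) (s - (u - v))
          + 1 / (2 * a) * (norm (s - (u - v)))\<^sup>2)"
proof -
  define d where "d = u - v"
  define e where "e = gradient f u - gradient f v"
  define e' where "e' = gradient h u - gradient h v"
  have "0 < \<tau>" using assms by simp
  have "s = (1 / \<tau>) *\<^sub>R (\<tau> *\<^sub>R s)" using \<open>0 < \<tau>\<close> by simp
  then have s': "s = (1 / \<tau>) *\<^sub>R (d + a *\<^sub>R e)"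
    unfolding s by (simp add: d_def e_def algebra_simps)
  define F where "F = f v - f u + inner (gradient f u) d"
  define H where "H = h v - h u + inner (gradient h u) d"
  have F: "a / \<tau> * (norm e)\<^sup>2 - K * (norm d)\<^sup>2 \<le> F"
    using gap unfolding F_def d_def e_def norm_minus_commute[of v u]
      norm_minus_commute[of "gradient f v"] by (simp add: inner_simps)
  \<comment> \<open>Expanding at \<open>v\<close> rather than \<open>u\<close> brings in
    \<open>inner e' d\<close>, which \<open>\<sigma>\<close> bounds from below.\<close>
  have "h u \<le> h v + inner (gradient h v) (u - v) + L_h / 2 * (norm (u - v))\<^sup>2"
    by (rule L_smooth_upper_bound[OF h])
  then have H: "inner e' d - L_h / 2 * (norm d)\<^sup>2 \<le> H"
    unfolding H_def e'_def d_def by (simp add: inner_simps)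
  have conv': "convex_on UNIV (\<lambda>u. h u + (- \<sigma>) / 2 * (norm u)\<^sup>2)" using conv by simp
  have mono: "\<sigma> * (norm d)\<^sup>2 \<le> inner e' d"
    using L_smooth_lower_bound[OF h conv', of u v] L_smooth_lower_bound[OF h conv', of v u]
    unfolding e'_def d_def norm_minus_commute[of v u] by (simp add: inner_simps)
  have "inner e' e \<le> norm e' * norm e" by (rule norm_cauchy_schwarz)
  also have "\<dots> \<le> (L_h * norm d) * (L_f * norm d)"
    unfolding e_def e'_def d_def using L_smooth_lipschitz[OF f] L_smooth_lipschitz[OF h]
    by (intro mult_mono) auto
  finally have cross: "inner e' e \<le> L_f * L_h * (norm d)\<^sup>2"
    by (simp add: power2_eq_square mult_ac)
  define A B c c' c'' where "A = (norm d)\<^sup>2" and "B = (norm e)\<^sup>2"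
    and "c = inner e d" and "c' = inner e' d" and "c'' = inner e' e"
  have es: "inner e s = (c + a * B) / \<tau>" and e's: "inner e' s = (c' + a * c'') / \<tau>"
    and ds: "inner d s = (A + a * c) / \<tau>"
    unfolding s' A_def B_def c_def c'_def c''_def power2_norm_eq_inner
    by (simp_all add: inner_simps inner_commute)
  define k where "k = 1 / (2 * a)"
  have sd: "(norm (s - d))\<^sup>2 = (norm s)\<^sup>2 - 2 * inner d s + A"
    unfolding A_def power2_norm_eq_inner by (simp add: inner_simps inner_commute)
  have "(f v + h v + inner (gradient f v + gradient h v) s + 1 / (2 * a) * (norm s)\<^sup>2)
      - (f u + h u + inner (gradient f u + gradient h u) (s - d) + 1 / (2 * a) * (norm (s - d))\<^sup>2)
      = F + H - inner e s - inner e' s + 1 / (2 * a) * (2 * inner d s - A)"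
    unfolding F_def H_def e_def e'_def unfolding k_def[symmetric] sd by (simp add: inner_simps algebra_simps)
  also have "\<dots> = F + H - (c + a * B) / \<tau> - (c' + a * c'') / \<tau>
      + 1 / (2 * a) * (2 * ((A + a * c) / \<tau>) - A)"
    unfolding es e's ds ..
  \<comment> \<open>The multiples of \<open>c\<close> from \<open>inner e s\<close> and
    \<open>inner d s\<close> cancel, so no product of \<open>d\<close> and \<open>e\<close>
    survives.\<close>
  also have "\<dots> = F - a / \<tau> * B + H - c' / \<tau> - a / \<tau> * c'' + (2 - \<tau>) / (2 * \<tau> * a) * A"
    using \<open>0 < \<tau>\<close> assms(5) by (simp add: field_simps)
  finally have eq: "(f v + h v + inner (gradient f v + gradient h v) s + 1 / (2 * a) * (norm s)\<^sup>2)
      - (f u + h u + inner (gradient f u + gradient h u) (s - d) + 1 / (2 * a) * (norm (s - d))\<^sup>2)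
      = F - a / \<tau> * B + H - c' / \<tau> - a / \<tau> * c'' + (2 - \<tau>) / (2 * \<tau> * a) * A" .
  \<comment> \<open>\<open>H\<close> contributes \<open>c'\<close> once and
    \<open>inner e' s\<close> removes the fraction \<open>1 / \<tau>\<close> of it;
    \<open>1 < \<tau>\<close> leaves a positive factor for the lower bound.\<close>
  have "(1 - 1 / \<tau>) * (\<sigma> * A) \<le> (1 - 1 / \<tau>) * c'"
    using mono assms(4) unfolding A_def c'_def by (intro mult_left_mono) auto
  moreover have "a / \<tau> * c'' \<le> a / \<tau> * (L_f * L_h * A)"
    using cross assms(5) \<open>0 < \<tau>\<close> unfolding A_def c''_def by (intro mult_left_mono) auto
  ultimately have "- K * A - L_h / 2 * A + (1 - 1 / \<tau>) * (\<sigma> * A) - a / \<tau> * (L_f * L_h * A)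
        + (2 - \<tau>) / (2 * \<tau> * a) * A
      \<le> F - a / \<tau> * B + H - c' / \<tau> - a / \<tau> * c'' + (2 - \<tau>) / (2 * \<tau> * a) * A"
    using F H unfolding A_def[symmetric] B_def[symmetric] c'_def[symmetric]
    by (simp add: left_diff_distrib)
  moreover have "- (2 * L_f * L_h * a\<^sup>2 + (\<tau> * L_h - 2 * (\<tau> - 1) * \<sigma> + 2 * \<tau> * K) * a - (2 - \<tau>))
        / (2 * \<tau> * a) * A = - K * A - L_h / 2 * A + (1 - 1 / \<tau>) * (\<sigma> * A)
        - a / \<tau> * (L_f * L_h * A) + (2 - \<tau>) / (2 * \<tau> * a) * A"
    using \<open>0 < \<tau>\<close> assms(5) by (simp add: field_simps power2_eq_square)
  ultimately show ?thesis unfolding A_def[symmetric] d_def[symmetric] eq by (simp only:)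
qed

section \<open>Optimality in the proximal steps and auxiliary bounds\<close>

lemma prox_smooth_stationary:
  fixes f :: "'a::euclidean_space \<Rightarrow> real"
  assumes f: "L_smooth L f" and "0 < a" and "x \<in> prox a (\<lambda>u. ereal (f u)) z"
  shows "z = x + a *\<^sub>R gradient f x"
proof -
  let ?\<phi> = "\<lambda>w. f w + 1 / (2 * a) * inner (w - z) (w - z)"
  have min: "?\<phi> x \<le> ?\<phi> w" for w
    using assms(3) unfolding prox_def is_arg_min_linorder power2_norm_eq_inner by simp
  have "(?\<phi> has_derivative (\<lambda>h. inner h (gradient f x + (1 / a) *\<^sub>R (x - z)))) (at x)"
    by (rule derivative_eq_intros L_smooth_has_derivative[OF f] refl)+
      (simp add: fun_eq_iff inner_simps inner_commute, simp add: algebra_simps diff_divide_distrib)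
  then have "(\<lambda>h. inner h (gradient f x + (1 / a) *\<^sub>R (x - z))) = (\<lambda>h. 0)"
    by (rule has_derivative_local_min) (intro always_eventually allI min)
  then have "gradient f x + (1 / a) *\<^sub>R (x - z) = 0"
    by (metis inner_eq_zero_iff)
  then have "a *\<^sub>R (gradient f x + (1 / a) *\<^sub>R (x - z)) = 0" by simp
  then show ?thesis using assms(2) by (simp add: algebra_simps)
qed

text \<open>Both quadratic bounds of \<open>h\<close> at 0 are compared at a unit vector. The result
  settles the case \<open>L_f = 0\<close> of the step size bound.\<close>

lemma strong_convexity_le_smoothness:
  fixes h :: "'a::euclidean_space \<Rightarrow> real"
  assumes h: "L_smooth L h" and conv: "convex_on UNIV (\<lambda>u. h u - \<sigma> / 2 * (norm u)\<^sup>2)"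
  shows "\<sigma> \<le> L"
proof -
  obtain b :: 'a where "b \<in> Basis" using nonempty_Basis by blast
  then have "norm b = 1" by simp
  have conv': "convex_on UNIV (\<lambda>u. h u + (- \<sigma>) / 2 * (norm u)\<^sup>2)" using conv by simp
  show ?thesis
    using L_smooth_lower_bound[OF h conv', of 0 b] L_smooth_upper_bound[OF h, of b 0] \<open>norm b = 1\<close>
    by simp
qed

text \<open>Finiteness lets \<open>g\<close> cancel between consecutive merit values.\<close>

lemma prox_finite:
  assumes "proper_fun g" and "w \<in> prox \<gamma> g c"
  shows "\<bar>g w\<bar> \<noteq> \<infinity>"
proof -
  obtain u where "g u \<noteq> \<infinity>" using assms(1) unfolding proper_fun_def by blast
  have "g w + ereal (1 / (2 * \<gamma>) * (norm (w - c))\<^sup>2) \<le> g u + ereal (1 / (2 * \<gamma>) * (norm (u - c))\<^sup>2)"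
    using assms(2) unfolding prox_def is_arg_min_linorder by simp
  then have "g w \<noteq> \<infinity>" using \<open>g u \<noteq> \<infinity>\<close> by (cases "g u") auto
  then show ?thesis using assms(1) unfolding proper_fun_def by auto
qed

text \<open>Since \<open>1 / \<gamma> = 1 / \<alpha> + rec \<beta>\<close>, completing the square
  turns the model into the proximal objective plus a constant.\<close>

lemma merit_eq_Phi:
  assumes "0 < \<alpha>" and "0 < \<gamma>" and \<gamma>: "1 / \<gamma> = 1 / \<alpha> + rec \<beta>"
    and "z = x + \<alpha> *\<^sub>R gradient f x"
    and "w \<in> prox \<gamma> g ((\<gamma> / \<alpha>) *\<^sub>R (2 *\<^sub>R x - z - \<alpha> *\<^sub>R gradient h x)
              + (\<gamma> * rec \<beta>) *\<^sub>R y - \<gamma> *\<^sub>R \<xi>)"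
  shows "merit f g h p \<alpha> \<beta> \<xi> y z x = Phi f g h p \<alpha> \<beta> \<xi> w y z x"
proof -
  define b where "b = rec \<beta>"
  \<comment> \<open>\<open>- v\<close> is the gradient at 0 of the quadratic part of the model, and
    \<open>K\<close> is the minimum of that part, attained at
    \<open>\<gamma> *\<^sub>R v\<close>.\<close>
  define v where "v = (1 / \<alpha>) *\<^sub>R x - gradient f x - gradient h x + b *\<^sub>R y - \<xi>"
  define K where "K = f x + h x - inner (gradient f x + gradient h x) x + 1 / (2 * \<alpha>) * inner x x
    + p y - inner \<xi> y + b / 2 * inner y y - \<gamma> / 2 * inner v v"
  have center: "(\<gamma> / \<alpha>) *\<^sub>R (2 *\<^sub>R x - z - \<alpha> *\<^sub>R gradient h x) + (\<gamma> * rec \<beta>) *\<^sub>R y - \<gamma> *\<^sub>R \<xi>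
      = \<gamma> *\<^sub>R v"
    unfolding assms(4) v_def b_def using assms(1)
    by (simp add: algebra_simps scaleR_2 flip: scaleR_add_left)
  have Phi: "Phi f g h p \<alpha> \<beta> \<xi> u y z x
      = ereal K + (g u + ereal (1 / (2 * \<gamma>) * (norm (u - \<gamma> *\<^sub>R v))\<^sup>2))" for u
  proof -
    have "1 / (2 * \<gamma>) * (norm (u - \<gamma> *\<^sub>R v))\<^sup>2
        = (1 / \<gamma>) / 2 * inner u u - inner u v + \<gamma> / 2 * inner v v"
      unfolding power2_norm_eq_inner using assms(2)
      by (simp add: inner_simps inner_commute field_simps)
    also have "\<dots> = 1 / (2 * \<alpha>) * inner u u + b / 2 * inner u u - inner u v + \<gamma> / 2 * inner v v"
      unfolding \<gamma> b_def by (simp add: field_simps)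
    finally have sq: "1 / (2 * \<gamma>) * (norm (u - \<gamma> *\<^sub>R v))\<^sup>2 = \<dots>" .
    have "f x + h x + inner (gradient f x + gradient h x) (u - x) + 1 / (2 * \<alpha>) * (norm (u - x))\<^sup>2
        + p y + inner \<xi> (u - y) + rec \<beta> / 2 * (norm (u - y))\<^sup>2
        = K + 1 / (2 * \<gamma>) * (norm (u - \<gamma> *\<^sub>R v))\<^sup>2"
      unfolding sq unfolding K_def v_def b_def[symmetric] power2_norm_eq_inner
      by (simp add: inner_simps inner_commute)
        (simp add: algebra_simps add_divide_distrib diff_divide_distrib inner_commute)
    then show ?thesis unfolding Phi_def by (cases "g u") auto
  qed
  have "Phi f g h p \<alpha> \<beta> \<xi> w y z x \<le> Phi f g h p \<alpha> \<beta> \<xi> u y z x" for u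
    using assms(5) unfolding Phi center prox_def is_arg_min_linorder by (simp add: add_left_mono)
  then show ?thesis unfolding merit_def by (intro antisym INF_lower INF_greatest) auto
qed

text \<open>For \<open>\<beta> = \<infinity>\<close> the first hypothesis forces
  \<open>r = 0 = rec \<beta>\<close>. For \<open>r = 0\<close> the second says that
  \<open>\<beta>\<close> is finite, so that \<open>rec \<beta> > 0\<close>.\<close>

lemma rec_ge_if_le_inverse:
  assumes "0 < \<beta>" and "0 \<le> r"
  shows "\<beta> \<le> inverse (ereal r) \<Longrightarrow> r \<le> rec \<beta>"
    and "\<beta> < inverse (ereal r) \<Longrightarrow> r < rec \<beta>"
  using assms unfolding rec_def by (cases \<beta>; cases "r = 0"; auto simp: field_simps)+

text \<open>Finiteness of \<open>V\<close> gives meaning to the extended real differences. Strict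
  decrease is tied to a moving iterate because the bound is 0 when neither \<open>x\<close> nor
  \<open>y\<close> moves.\<close>

theorem theorem3p9:
  fixes f h p :: "real ^ 'n \<Rightarrow> real" and g :: "real ^ 'n \<Rightarrow> ereal"
    and L_f L_h \<rho>_f \<sigma>_h \<rho>_p \<tau> \<alpha> \<gamma> :: real and \<beta> :: ereal
    and x y z \<xi> :: "nat \<Rightarrow> real ^ 'n" and V :: "nat \<Rightarrow> ereal"
  assumes "L_smooth L_f f"
    and "proper_fun g" and "lsc_fun g"
    and "L_smooth L_h h"
    and "\<exists>U. open U \<and> eff_domain g \<subseteq> U \<and> continuous_on U p"
    and "0 \<le> \<rho>_p" and "weakly_convex \<rho>_p (\<lambda>u. - p u)"
    and "L_f + L_h > 0"
    and "0 \<le> \<rho>_f" and "\<rho>_f \<le> L_f" and "weakly_convex \<rho>_f f"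
    and "convex_on UNIV (\<lambda>u. h u - \<sigma>_h / 2 * (norm u)\<^sup>2)"
    and "1 < \<tau>" and "\<tau> < 2"
    and "0 < \<alpha>" and "\<alpha> \<le> alpha_bar \<tau> L_f L_h \<rho>_f \<sigma>_h"
    and "0 < \<beta>" and "0 < \<gamma>" and "1 / \<gamma> = 1 / \<alpha> + rec \<beta>"
    and "generated_by_algorithm f g h p \<tau> \<alpha> \<beta> \<gamma> x y z \<xi>"
    and "V = (\<lambda>k. merit f g h p \<alpha> \<beta> (\<xi> k) (y k) (z k) (x k))"
  shows "(\<forall>k. \<bar>V k\<bar> \<noteq> \<infinity>) \<and>
    (\<forall>k\<ge>1. V (k - 1) - V k \<ge>
       ereal (- coeff_c \<tau> L_f L_h \<rho>_f \<sigma>_h \<alpha> / (2 * \<tau> * \<alpha>) * (norm (x k - x (k - 1)))\<^sup>2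
              + (rec \<beta> / 2 - \<rho>_p / 2) * (norm (y k - y (k - 1)))\<^sup>2)) \<and>
    (\<beta> \<le> inverse (ereal \<rho>_p) \<longrightarrow> decseq V) \<and>
    (\<beta> \<le> inverse (ereal \<rho>_p) \<and> \<alpha> < alpha_bar \<tau> L_f L_h \<rho>_f \<sigma>_h \<longrightarrow>
       (\<forall>k\<ge>1. x k \<noteq> x (k - 1) \<longrightarrow> V k < V (k - 1))) \<and>
    (\<beta> < inverse (ereal \<rho>_p) \<longrightarrow>
       (\<forall>k\<ge>1. y k \<noteq> y (k - 1) \<longrightarrow> V k < V (k - 1)))"
proof -
  note f = assms(1) and h = assms(4)
  have \<tau>: "0 < \<tau>" using assms(13) by simp
  have sub: "\<xi> k \<in> limiting_subdiff p (y k)"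
    and ystep: "y (Suc k) \<in> prox \<gamma> g
            ((\<gamma> / \<alpha>) *\<^sub>R (2 *\<^sub>R x k - z k - \<alpha> *\<^sub>R gradient h (x k))
              + (\<gamma> * rec \<beta>) *\<^sub>R y k - \<gamma> *\<^sub>R \<xi> k)"
    and zstep: "z (Suc k) = z k + \<tau> *\<^sub>R (y (Suc k) - x k)"
    and zx: "z k = x k + \<alpha> *\<^sub>R gradient f (x k)" for k
    using assms(20) prox_smooth_stationary[OF f assms(15)]
    unfolding generated_by_algorithm_def by blast+
  define c where "c = coeff_c \<tau> L_f L_h \<rho>_f \<sigma>_h \<alpha>"
  have \<sigma>: "\<sigma>_h \<le> L_h" by (rule strong_convexity_le_smoothness[OF h assms(12)])
  have Lh: "0 \<le> L_h" by (rule L_smooth_lipschitz(1)[OF h])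
  note coeff = coeff_c_cases[OF assms(9,10) Lh assms(8) \<sigma> assms(13-16), folded c_def]
  define m where "m k w = (f (x k) + h (x k)) + inner (gradient f (x k) + gradient h (x k)) (w - x k)
    + 1 / (2 * \<alpha>) * (norm (w - x k))\<^sup>2 + p (y k) + inner (\<xi> k) (w - y k)
    + rec \<beta> / 2 * (norm (w - y k))\<^sup>2" for k w
  have g_fin: "\<bar>g (y (Suc k))\<bar> \<noteq> \<infinity>" for k by (rule prox_finite[OF assms(2) ystep])
  \<comment> \<open>\<open>y (Suc k)\<close> is the minimizer of stage \<open>k\<close> and the base
    point of stage \<open>k + 1\<close>; \<open>G k\<close> is the value of \<open>g\<close> shared
    by both models there.\<close>
  define G where "G k = real_of_ereal (g (y (Suc k)))" for k
  have G: "g (y (Suc k)) = ereal (G k)" for k using g_fin by (simp add: G_def ereal_real)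
  define v where "v k = m k (y (Suc k)) + G k" for k
  have Phi: "Phi f g h p \<alpha> \<beta> (\<xi> k) w (y k) (z k) (x k) = ereal (m k w) + g w" for k w
    unfolding Phi_def m_def ..
  have V: "V k = ereal (v k)" for k
    unfolding assms(21) merit_eq_Phi[OF assms(15,18,19) zx ystep] Phi G v_def by simp
  \<comment> \<open>Testing the infimum for stage \<open>k + 1\<close> at \<open>y (Suc k)\<close>
    makes the same \<open>G k\<close> appear as in \<open>v k\<close>.\<close>
  have V_le: "v (Suc k) \<le> m (Suc k) (y (Suc k)) + G k" for k
  proof -
    have "V (Suc k) \<le> Phi f g h p \<alpha> \<beta> (\<xi> (Suc k)) (y (Suc k)) (y (Suc k)) (z (Suc k)) (x (Suc k))"
      unfolding assms(21) merit_def by (rule INF_lower) simp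
    then show ?thesis unfolding V Phi G by simp
  qed
  have descent: "- c / (2 * \<tau> * \<alpha>) * (norm (x (Suc k) - x k))\<^sup>2
      + (rec \<beta> / 2 - \<rho>_p / 2) * (norm (y (Suc k) - y k))\<^sup>2 \<le> v k - v (Suc k)" for k
  proof -
    define s where "s = y (Suc k) - x k"
    have s: "\<tau> *\<^sub>R s = (x (Suc k) + \<alpha> *\<^sub>R gradient f (x (Suc k))) - (x k + \<alpha> *\<^sub>R gradient f (x k))"
      using zstep[of k] unfolding zx s_def by (simp add: algebra_simps)
    note decrease = model_decrease[OF f h assms(12,13,15) s]
    let ?D = "(f (x k) + h (x k) + inner (gradient f (x k) + gradient h (x k)) s
        + 1 / (2 * \<alpha>) * (norm s)\<^sup>2)
      - (f (x (Suc k)) + h (x (Suc k))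
          + inner (gradient f (x (Suc k)) + gradient h (x (Suc k))) (s - (x (Suc k) - x k))
          + 1 / (2 * \<alpha>) * (norm (s - (x (Suc k) - x k)))\<^sup>2)"
    have "- c / (2 * \<tau> * \<alpha>) * (norm (x (Suc k) - x k))\<^sup>2 \<le> ?D"
      using coeff(1)
    proof (elim disjE conjE exE)
      assume *: "\<rho>_f < L_f" "\<tau> \<le> 2 * \<alpha> * (L_f - \<rho>_f)" "c = poly_c1 \<tau> L_f L_h \<sigma>_h \<alpha>"
      have "- (- (L_f / 2 - \<alpha> * L_f\<^sup>2 / \<tau>)) * (norm (x k - x (Suc k)))\<^sup>2
          \<le> f (x k) - f (x (Suc k)) - inner (gradient f (x (Suc k))) (x k - x (Suc k))
            - \<alpha> / \<tau> * (norm (gradient f (x k) - gradient f (x (Suc k))))\<^sup>2"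
        using L_smooth_descent_gap(2)[OF f assms(11) \<tau> *(1,2)] by simp
      note decrease[OF this]
      moreover have "2 * L_f * L_h * \<alpha>\<^sup>2 + (\<tau> * L_h - 2 * (\<tau> - 1) * \<sigma>_h
          + 2 * \<tau> * (- (L_f / 2 - \<alpha> * L_f\<^sup>2 / \<tau>))) * \<alpha> - (2 - \<tau>) = c"
        unfolding *(3) poly_c1_def using \<tau> by (simp add: field_simps power2_eq_square)
      ultimately show ?thesis by (simp only:)
    next
      fix \<eta> assume *: "0 < \<eta>" "L_f - \<rho>_f \<le> \<eta>" "2 * \<alpha> * \<eta> \<le> \<tau>"
        "c = poly_c2 \<tau> L_f L_h \<rho>_f \<sigma>_h \<eta> \<alpha>"
      note decrease[OF L_smooth_descent_gap(1)[OF f assms(11) \<tau> *(1-3)]]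
      moreover have "2 * L_f * L_h * \<alpha>\<^sup>2 + (\<tau> * L_h - 2 * (\<tau> - 1) * \<sigma>_h
          + 2 * \<tau> * (\<rho>_f * (\<eta> + \<rho>_f) / (2 * \<eta>))) * \<alpha> - (2 - \<tau>) = c"
        unfolding *(4) poly_c2_def using *(1) by (simp add: field_simps power2_eq_square)
      ultimately show ?thesis by (simp only:)
    qed
    moreover have "p (y (Suc k)) \<le> p (y k) + inner (\<xi> k) (y (Suc k) - y k)
        + \<rho>_p / 2 * (norm (y (Suc k) - y k))\<^sup>2"
      by (rule limiting_subdiff_upper_bound[OF assms(7) sub])
    moreover have "s - (x (Suc k) - x k) = y (Suc k) - x (Suc k)" by (simp add: s_def)
    \<comment> \<open>At its base point \<open>y (Suc k)\<close> the model of stage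
      \<open>k + 1\<close> loses its \<open>\<xi>\<close> and \<open>\<beta>\<close> terms.\<close>
    then have "m k (y (Suc k)) - m (Suc k) (y (Suc k)) = ?D + p (y k) - p (y (Suc k))
        + inner (\<xi> k) (y (Suc k) - y k) + rec \<beta> / 2 * (norm (y (Suc k) - y k))\<^sup>2"
      unfolding m_def s_def by simp
    ultimately show ?thesis
      using V_le[of k] unfolding v_def[of k] left_diff_distrib by linarith
  qed
  have x_term: "0 \<le> - c / (2 * \<tau> * \<alpha>) * (norm w)\<^sup>2" for w :: "real ^ 'n"
    using coeff(2) \<tau> assms(15) by (intro mult_nonneg_nonneg divide_nonneg_pos) auto
  have y_term: "0 \<le> (rec \<beta> / 2 - \<rho>_p / 2) * (norm w)\<^sup>2" if "\<beta> \<le> inverse (ereal \<rho>_p)" for w :: "real ^ 'n"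
    using rec_ge_if_le_inverse(1)[OF assms(17,6) that] by simp
  have "V (k - 1) - V k \<ge>
       ereal (- c / (2 * \<tau> * \<alpha>) * (norm (x k - x (k - 1)))\<^sup>2
              + (rec \<beta> / 2 - \<rho>_p / 2) * (norm (y k - y (k - 1)))\<^sup>2)" if "1 \<le> k" for k
    using descent[of "k - 1"] that unfolding V by simp
  moreover have "decseq V" if "\<beta> \<le> inverse (ereal \<rho>_p)"
  proof (rule decseq_SucI)
    fix k
    show "V (Suc k) \<le> V k"
      unfolding V using descent[of k] x_term[of "x (Suc k) - x k"] y_term[OF that, of "y (Suc k) - y k"]
      by simp
  qed
  moreover have "V k < V (k - 1)"
    if "\<beta> \<le> inverse (ereal \<rho>_p)" "\<alpha> < alpha_bar \<tau> L_f L_h \<rho>_f \<sigma>_h" "1 \<le> k" "x k \<noteq> x (k - 1)" for k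
  proof -
    have "0 < - c / (2 * \<tau> * \<alpha>) * (norm (x k - x (k - 1)))\<^sup>2"
      using coeff(3)[OF that(2)] \<tau> assms(15) that(4) by (intro mult_pos_pos divide_pos_pos) auto
    then show ?thesis
      unfolding V using descent[of "k - 1"] y_term[OF that(1), of "y k - y (k - 1)"] that(3) by simp
  qed
  moreover have "V k < V (k - 1)"
    if "\<beta> < inverse (ereal \<rho>_p)" "1 \<le> k" "y k \<noteq> y (k - 1)" for k
  proof -
    have "0 < (rec \<beta> / 2 - \<rho>_p / 2) * (norm (y k - y (k - 1)))\<^sup>2"
      using rec_ge_if_le_inverse(2)[OF assms(17,6) that(1)] that(3) by simp
    then show ?thesis
      unfolding V using descent[of "k - 1"] x_term[of "x k - x (k - 1)"] that(2) by simp
  qed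
  moreover have "\<forall>k. \<bar>V k\<bar> \<noteq> \<infinity>" by (simp add: V)
  ultimately show ?thesis unfolding c_def[symmetric] by blast
qed

thm_deps theorem3p9

end
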